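(* The correction function $C_*$ is well-defined on all of $\mathbb{R}$ (the denominators occurring in its definition never vanish) and satisfies $0 < C_*(L) < 2$ for all $L \in \mathbb{R}$. Moreover, $$\lim_{L \to -\infty} C_*(L) = 0, \qquad \lim_{L \to \infty} C_*(L) = 2,$$ and hence $C_*(\mathbb{R}) = (0,2)$.
   Context: The real variable $L$ stands for the quantity $L_f(x) = f(x)f''(x)/f'(x)^2$, regarded as ranging over all of $\mathbb{R}$. The correction function $C_*$ of the proposed iterative method is defined for $L \in \mathbb{R}$ by $$C_*(L) = \frac{2}{1 + B(L)}, \qquad B(L) = \frac{1 - L + \frac{1}{2}L^2}{1 - L + L^2}\left(\sqrt{1 + L^2} - L\right).$$ *)

theory Defs
  imports Complex_Main
begin

(* Division in HOL is total (x / 0 = 0) and sqrt is odd on the negative reals, so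
   well-definedness of these expressions is not enforced by the definitions themselves. *)

definition B :: "real \<Rightarrow> real" where
  "B L = (1 - L + (1 / 2) * L\<^sup>2) / (1 - L + L\<^sup>2) * (sqrt (1 + L\<^sup>2) - L)"

definition C_star :: "real \<Rightarrow> real" where
  "C_star L = 2 / (1 + B L)"

end

theory Submission
  imports Defs "HOL-Real_Asymp.Real_Asymp"
begin

text \<open>Everything rests on \<open>B_pos\<close>: both quadratics in \<open>B\<close> have
  negative discriminant, and the square root exceeds \<open>L\<close>, so
  \<open>1 + B L > 1\<close>. This gives well-definedness and the bounds at once. Since
  \<open>C_star\<close> is continuous with limits 0 and 2 at the two ends, the intermediate value
  theorem fills the whole open interval.\<close>

lemma denom_pos: "1 - L + L\<^sup>2 > 0" for L :: real
proof -
  have "1 - L + L\<^sup>2 = (L - 1/2)\<^sup>2 + 3/4"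
    by (simp add: power2_eq_square algebra_simps)
  then show ?thesis
    by (smt (verit) zero_le_power2 divide_pos_pos)
qed

lemma B_pos: "B L > 0"
proof -
  have "1 - L + (1/2) * L\<^sup>2 = (1/2) * (L - 1)\<^sup>2 + 1/2"
    by (simp add: power2_eq_square field_simps)
  then have "1 - L + (1/2) * L\<^sup>2 > 0"
    by (smt (verit) zero_le_power2 divide_pos_pos mult_nonneg_nonneg)
  \<comment> \<open>Comparing squares suffices for either sign of \<open>L\<close>.\<close>
  moreover have "L < sqrt (1 + L\<^sup>2)"
    by (rule real_less_rsqrt) simp
  ultimately show ?thesis
    unfolding B_def using denom_pos[of L] by simp
qed

lemma C_star_bounds: "0 < C_star L" "C_star L < 2"
  using B_pos[of L] by (simp_all add: C_star_def field_simps)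

text \<open>The rational factor of \<open>B\<close> tends to 1/2 while
  \<open>sqrt (1 + L\<^sup>2) - L\<close> grows like \<open>-2 * L\<close>, so \<open>B\<close>
  tends to infinity.\<close>

lemma C_star_at_bot: "(C_star \<longlongrightarrow> 0) at_bot"
  unfolding C_star_def [abs_def] B_def by real_asymp

text \<open>Here \<open>sqrt (1 + L\<^sup>2) - L = 1 / (sqrt (1 + L\<^sup>2) + L)\<close> tends to
  0, and the rational factor again tends to 1/2, so \<open>B\<close> vanishes in the limit.\<close>

lemma C_star_at_top: "(C_star \<longlongrightarrow> 2) at_top"
  unfolding C_star_def [abs_def] B_def by real_asymp

lemma continuous_on_C_star: "continuous_on UNIV C_star"
proof -
  have "continuous_on UNIV B"
    unfolding B_def [abs_def] using denom_pos
    by (intro continuous_intros) (auto simp: less_imp_neq[THEN not_sym])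
  moreover have "1 + B L \<noteq> 0" for L
    using B_pos[of L] by simp
  ultimately show ?thesis
    unfolding C_star_def [abs_def] by (intro continuous_intros) auto
qed

lemma range_C_star: "range C_star = {0<..<2}"
proof
  show "range C_star \<subseteq> {0<..<2}"
    using C_star_bounds by auto
  show "{0<..<2} \<subseteq> range C_star"
  proof
    fix c :: real
    assume c: "c \<in> {0<..<2}"
    \<comment> \<open>As \<open>c\<close> lies strictly between the two limits,
      \<open>C_star\<close> takes values on both sides of it; connectedness of the range then
      captures \<open>c\<close>, whatever the order of \<open>a\<close> and
      \<open>b\<close>.\<close>
    obtain a where "C_star a < c"
      using order_tendstoD(2)[OF C_star_at_bot, of c] c
      by (auto dest: eventually_happens)
    moreover obtain b where "c < C_star b"
      using order_tendstoD(1)[OF C_star_at_top, of c] c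
      by (auto dest: eventually_happens)
    moreover have "connected (range C_star)"
      using continuous_on_C_star by (rule connected_continuous_image) simp
    ultimately show "c \<in> range C_star"
      by (meson connectedD_interval less_imp_le rangeI)
  qed
qed

theorem proposition3p1:
  shows "(\<forall>L::real. 0 \<le> 1 + L\<^sup>2 \<and> 1 - L + L\<^sup>2 \<noteq> 0 \<and> 1 + B L \<noteq> 0)
    \<and> (\<forall>L::real. 0 < C_star L \<and> C_star L < 2)
    \<and> (C_star \<longlongrightarrow> 0) at_bot
    \<and> (C_star \<longlongrightarrow> 2) at_top
    \<and> range C_star = {0<..<2}"
proof (intro conjI allI)
  fix L :: real
  show "0 \<le> 1 + L\<^sup>2" by simp
  show "1 - L + L\<^sup>2 \<noteq> 0" using denom_pos[of L] by simp
  show "1 + B L \<noteq> 0" using B_pos[of L] by simp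
qed (fact C_star_bounds C_star_at_bot C_star_at_top range_C_star)+

end
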